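(* Let $N\ge2$ and $M\ge1$, and let the entries $x_{m,i}$ ($1\le m\le M$, $1\le i\le N$) be i.i.d. real random variables with $\mathbb E[x]=0$ and $0<\mathbb E[x^2]<\infty$. Then the optimization problem $\min_{\mathbf w}\hat\ell(\mathbf w)$ for the product node with neutral element is non-convex in $\mathbf w$, in the following sense: there exist weights $\mathbf w\in\mathbb R^N$, oracle weights $\mathbf w^{\mathrm{true}}\in\mathbb R^N$ and a test vector $\mathbf q\in\mathbb R^N$ such that $$\mathbf q^T\,\mathbb E\big[\nabla^2_{\mathbf w}\hat\ell(\mathbf w)\big]\,\mathbf q<0,$$ so that the Hessian matrix is not always positive semi-definite.
   Context: The product node with neutral element with weights $\mathbf w\in\mathbb R^N$ maps $\mathbf x\in\mathbb R^N$ to $f(\mathbf w;\mathbf x)=\prod_{i=1}^N\big(w_ix_i+(1-w_i)\big)$. Targets are $y_m^{\mathrm{true}}=f(\mathbf w^{\mathrm{true}};\mathbf x_m)$ and the empirical risk is $\hat\ell(\mathbf w)=\frac1M\sum_{m=1}^M\big(f(\mathbf w;\mathbf x_m)-y_m^{\mathrm{true}}\big)^2$. *)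

theory Defs
  imports "HOL-Probability.Probability"
begin

definition product_node :: "real ^ 'n \<Rightarrow> real ^ 'n \<Rightarrow> real" where
  "product_node w x = (\<Prod>i\<in>UNIV. w $ i * x $ i + (1 - w $ i))"

definition empirical_risk ::
    "nat \<Rightarrow> (nat \<Rightarrow> real ^ 'n) \<Rightarrow> real ^ 'n \<Rightarrow> real ^ 'n \<Rightarrow> real" where
  "empirical_risk M x w_true w =
     (1 / real M) * (\<Sum>m=1..M. (product_node w (x m) - product_node w_true (x m))\<^sup>2)"

definition partial_deriv :: "'n \<Rightarrow> (real ^ 'n \<Rightarrow> real) \<Rightarrow> real ^ 'n \<Rightarrow> real" where
  "partial_deriv i f w = deriv (\<lambda>t. f (w + t *\<^sub>R axis i 1)) 0"

definition hessian :: "(real ^ 'n \<Rightarrow> real) \<Rightarrow> real ^ 'n \<Rightarrow> real ^ 'n ^ 'n" where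
  "hessian f w = (\<chi> i j. partial_deriv i (partial_deriv j f) w)"

(* Symmetry is deliberately not part of this predicate, so that its negation
   always exhibits a direction of negative curvature. *)
definition positive_semidefinite :: "real ^ 'n ^ 'n \<Rightarrow> bool" where
  "positive_semidefinite A \<longleftrightarrow> (\<forall>q. 0 \<le> q \<bullet> (A *v q))"

end

theory Submission
  imports Defs
begin

text \<open>
  Put \<open>d\<^sub>i = x\<^sub>i - 1\<close>, so that the node is \<open>\<Prod>\<^sub>i (1 + w\<^sub>i d\<^sub>i)\<close>. At \<open>w = 0\<close> it equals 1, and
  one sample with target \<open>y\<close> contributes \<open>2 d\<^sub>i\<^sup>2\<close> to the diagonal and \<open>2 (2 - y) d\<^sub>i d\<^sub>j\<close> to the
  off-diagonal entries of the Hessian. For oracle weights \<open>3 e\<^sub>a + 3 e\<^sub>b\<close> and \<open>q = e\<^sub>a + e\<^sub>b\<close>,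
  independence gives the expectation
  \<open>2 (s\<^sub>a + 1) + 2 (s\<^sub>b + 1) + 8 - 4 (3 s\<^sub>a + 2) (3 s\<^sub>b + 2) < 0\<close>, where \<open>s\<^sub>i\<close> is the second moment
  of \<open>x\<^sub>i\<close>. Every expectation that occurs is of a product over distinct coordinates of polynomials
  of degree at most 2, so that finite second moments suffice.
\<close>

section \<open>Derivatives of the node and of the empirical risk\<close>

lemma product_node_altdef: "product_node w x = (\<Prod>k\<in>UNIV. 1 + w $ k * (x $ k - 1))"
  unfolding product_node_def by (rule prod.cong) (auto simp: algebra_simps)

text \<open>The node is affine in each single weight: only factor \<open>j\<close> depends on
  \<open>t\<close>, so the derivative along axis \<open>j\<close> can be read off.\<close>

lemma product_node_line:
  "product_node (w + t *\<^sub>R axis j 1) x =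
     (1 + (w $ j + t) * (x $ j - 1)) * (\<Prod>k\<in>UNIV - {j}. 1 + w $ k * (x $ k - 1))"
proof -
  have "product_node (w + t *\<^sub>R axis j 1) x =
      (1 + (w + t *\<^sub>R axis j 1) $ j * (x $ j - 1)) *
      (\<Prod>k\<in>UNIV - {j}. 1 + (w + t *\<^sub>R axis j 1) $ k * (x $ k - 1))"
    unfolding product_node_altdef by (subst prod.remove[of _ j]) auto
  also have "(\<Prod>k\<in>UNIV - {j}. 1 + (w + t *\<^sub>R axis j 1) $ k * (x $ k - 1)) =
      (\<Prod>k\<in>UNIV - {j}. 1 + w $ k * (x $ k - 1))"
    by (rule prod.cong) (auto simp: axis_def)
  finally show ?thesis by (simp add: axis_def)
qed

lemma partial_deriv_empirical_risk:
  "partial_deriv j (empirical_risk M x w_true) w =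
     1 / real M * (\<Sum>m=1..M. 2 * (product_node w (x m) - product_node w_true (x m)) *
       ((x m $ j - 1) * (\<Prod>k\<in>UNIV - {j}. 1 + w $ k * (x m $ k - 1))))"
proof -
  \<comment> \<open>The case \<open>t = 0\<close> puts the node at \<open>w\<close> into the same
    factored form as on the line, so that the two sides of the derivative match.\<close>
  have w: "product_node w y = (1 + w $ j * (y $ j - 1)) *
      (\<Prod>k\<in>UNIV - {j}. 1 + w $ k * (y $ k - 1))" for y
    using product_node_line[of w 0 j y] by simp
  show ?thesis
    unfolding partial_deriv_def empirical_risk_def product_node_line w[of "x _"]
    by (rule DERIV_imp_deriv, (rule derivative_eq_intros refl)+)
      (auto intro!: sum.cong simp: algebra_simps)
qed

text \<open>Along axis \<open>i\<close> from the origin all factors but the \<open>i\<close>-th stay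
  1, so every product collapses. Affinity in each weight makes the pure second derivatives of the
  node vanish; on the diagonal only the squared first derivative survives.\<close>

lemma hessian_empirical_risk_0:
  "hessian (empirical_risk M x w_true) 0 $ i $ j =
     1 / real M * (\<Sum>m=1..M. 2 * ((x m $ i - 1) * (x m $ j - 1)) +
       (if i = j then 0
        else 2 * (1 - product_node w_true (x m)) * ((x m $ i - 1) * (x m $ j - 1))))"
proof -
  have p: "product_node (0 + t *\<^sub>R axis i 1) y = 1 + t * (y $ i - 1)" for t and y :: "real ^ 'a"
    by (subst product_node_line) simp
  \<comment> \<open>The product without factor \<open>j\<close> still contains the moving factor
    exactly when \<open>i\<close> differs from \<open>j\<close>.\<close>
  have r: "(\<Prod>k\<in>UNIV - {j}. 1 + (0 + t *\<^sub>R axis i 1) $ k * (y $ k - 1)) =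
      1 + t * (if i = j then 0 else y $ i - 1)" for t and y :: "real ^ 'a"
  proof -
    have "(\<Prod>k\<in>UNIV - {j}. 1 + (0 + t *\<^sub>R axis i 1) $ k * (y $ k - 1)) =
        (\<Prod>k\<in>UNIV - {j}. if k = i then 1 + t * (y $ i - 1) else 1)"
      by (rule prod.cong) (auto simp: axis_def)
    then show ?thesis by (simp add: prod.delta)
  qed
  show ?thesis
    unfolding hessian_def vec_lambda_beta
    unfolding partial_deriv_def[of i] partial_deriv_empirical_risk p r
    by (rule DERIV_imp_deriv, (rule derivative_eq_intros refl)+)
      (auto intro!: sum.cong simp: algebra_simps)
qed

section \<open>Integration of matrix-valued functions\<close>

lemma matrix_eq_sum_axis:
  fixes A :: "real ^ 'n ^ 'm"
  shows "A = (\<Sum>i\<in>UNIV. \<Sum>j\<in>UNIV. (A $ i $ j) *\<^sub>R axis i (axis j 1))"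
proof -
  have "(\<Sum>i\<in>UNIV. \<Sum>j\<in>UNIV. (A $ i $ j) *\<^sub>R axis i (axis j 1)) $ k $ l = A $ k $ l" for k l
  proof -
    have "(\<Sum>i\<in>UNIV. \<Sum>j\<in>UNIV. (A $ i $ j) *\<^sub>R axis i (axis j 1)) $ k $ l =
       (\<Sum>i\<in>UNIV. \<Sum>j\<in>UNIV. if i = k then if j = l then A $ k $ l else 0 else 0)"
      unfolding sum_component by (intro sum.cong refl) (auto simp: axis_def)
    also have "\<dots> = (\<Sum>i\<in>UNIV. if i = k then A $ k $ l else 0)"
      by (intro sum.cong refl) (auto simp: sum.delta)
    also have "\<dots> = A $ k $ l"
      by simp
    finally show ?thesis .
  qed
  then show ?thesis by (simp add: vec_eq_iff)
qed

text \<open>The expansion in matrix units is a finite sum of scalar integrable functions times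
  constant matrices.\<close>

lemma integrable_matrixI:
  fixes A :: "'a \<Rightarrow> real ^ 'n ^ 'm"
  assumes "\<And>i j. integrable P (\<lambda>\<omega>. A \<omega> $ i $ j)"
  shows "integrable P A"
proof -
  have "integrable P (\<lambda>\<omega>. \<Sum>i\<in>UNIV. \<Sum>j\<in>UNIV. (A \<omega> $ i $ j) *\<^sub>R axis i (axis j 1))"
    using assms by (intro Bochner_Integration.integrable_sum integrable_scaleR_left) auto
  also have "(\<lambda>\<omega>. \<Sum>i\<in>UNIV. \<Sum>j\<in>UNIV. (A \<omega> $ i $ j) *\<^sub>R axis i (axis j 1)) = A"
    by (rule ext) (rule matrix_eq_sum_axis[symmetric])
  finally show ?thesis .
qed

text \<open>For fixed \<open>q\<close> the form is linear in the matrix, hence bounded in finite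
  dimension. This lets it commute with the expectation.\<close>

lemma bounded_linear_quadratic_form:
  "bounded_linear (\<lambda>A :: real ^ 'n ^ 'n. q \<bullet> (A *v q))"
  by (rule linear_conv_bounded_linear[THEN iffD1], rule linearI)
    (simp_all add: inner_add_right matrix_vector_mult_add_rdistrib scaleR_matrix_vector_assoc [symmetric])

lemma inner_matrix_axis: "axis i 1 \<bullet> ((A :: real ^ 'n ^ 'm) *v axis j 1) = A $ i $ j"
  by (simp add: inner_axis' matrix_vector_mul_component inner_axis)

section \<open>Independence and moments\<close>

lemma (in prob_space) indep_vars_reindex:
  assumes "inj_on f I" and ind: "indep_vars M' X (f ` I)"
  shows "indep_vars (M' \<circ> f) (X \<circ> f) I"
proof -
  define F where "F = (\<lambda>i. {X i -` A \<inter> space M |A. A \<in> sets (M' i)})"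
  have F: "indep_sets F (f ` I)" and rv: "\<And>i. i \<in> I \<Longrightarrow> random_variable (M' (f i)) (X (f i))"
    using ind by (auto simp: indep_vars_def2 F_def)
  have "indep_sets (F \<circ> f) I"
  proof (rule indep_setsI)
    show "(F \<circ> f) i \<subseteq> events" if "i \<in> I" for i
      using F that by (auto simp: indep_sets_def)
  next
    fix A J
    assume J: "J \<noteq> {}" "J \<subseteq> I" "finite J" "\<forall>j\<in>J. A j \<in> (F \<circ> f) j"
    have inj: "inj_on f J" using \<open>inj_on f I\<close> J(2) by (rule inj_on_subset)
    \<comment> \<open>The events are carried over to the image by the inverse of \<open>f\<close> on
      \<open>J\<close>.\<close>
    have "prob (\<Inter>k\<in>f ` J. A (inv_into J f k)) = (\<Prod>k\<in>f ` J. prob (A (inv_into J f k)))"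
      by (rule indep_setsD[OF F]) (use J inj in auto)
    then show "prob (\<Inter>j\<in>J. A j) = (\<Prod>j\<in>J. prob (A j))"
      using inj by (simp add: prod.reindex)
  qed
  with rv show ?thesis by (simp add: indep_vars_def2 F_def comp_def)
qed

lemma (in prob_space) second_moment_shift:
  fixes X :: "'a \<Rightarrow> real"
  assumes X: "random_variable borel X" and X2: "integrable M (\<lambda>\<omega>. (X \<omega>)\<^sup>2)"
    and mean: "expectation X = 0"
  shows "integrable M X"
    and "integrable M (\<lambda>\<omega>. (X \<omega> - 1)\<^sup>2)"
    and "expectation (\<lambda>\<omega>. (X \<omega> - 1)\<^sup>2) = expectation (\<lambda>\<omega>. (X \<omega>)\<^sup>2) + 1"
proof -
  show i: "integrable M X"
    by (rule square_integrable_imp_integrable) (use assms in auto)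
  have eq: "(\<lambda>\<omega>. (X \<omega> - 1)\<^sup>2) = (\<lambda>\<omega>. (X \<omega>)\<^sup>2 - 2 * X \<omega> + 1)"
    by (auto simp: power2_eq_square algebra_simps)
  show "integrable M (\<lambda>\<omega>. (X \<omega> - 1)\<^sup>2)"
    unfolding eq using i X2 by auto
  show "expectation (\<lambda>\<omega>. (X \<omega> - 1)\<^sup>2) = expectation (\<lambda>\<omega>. (X \<omega>)\<^sup>2) + 1"
    unfolding eq using i X2 mean by (simp add: prob_space)
qed

text \<open>The two extra factors are merged with the node's factors of the same coordinate. Each
  coordinate then occurs in one factor only, and independence turns the expectation into a product.
  With d = x - 1, E d = -1 and E d^2 = s + 1, a merged factor d (1 + v d) has mean v (s + 1) - 1,
  any other factor 1 + v d has mean 1 - v.\<close>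

lemma (in prob_space) product_node_mixed_moment:
  fixes X :: "'a \<Rightarrow> real ^ 'n"
  assumes ind: "indep_vars (\<lambda>_. borel) (\<lambda>k \<omega>. X \<omega> $ k) UNIV"
    and X2: "\<And>k. integrable M (\<lambda>\<omega>. (X \<omega> $ k)\<^sup>2)"
    and mean: "\<And>k. expectation (\<lambda>\<omega>. X \<omega> $ k) = 0"
    and "i \<noteq> j"
  defines "Y \<equiv> \<lambda>v \<omega>. (X \<omega> $ i - 1) * (X \<omega> $ j - 1) * product_node v (X \<omega>)"
  shows "integrable M (Y v)"
    and "expectation (Y v) = (\<Prod>k\<in>UNIV. if k \<in> {i, j}
           then v $ k * (expectation (\<lambda>\<omega>. (X \<omega> $ k)\<^sup>2) + 1) - 1 else 1 - v $ k)"
proof -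
  define g where "g k u = (if k \<in> {i, j} then u - 1 else 1) * (1 + v $ k * (u - 1))" for k and u :: real
  have meas: "random_variable borel (\<lambda>\<omega>. X \<omega> $ k)" for k
    using ind by (auto simp: indep_vars_def)
  note sm = second_moment_shift[OF meas X2 mean]
  have g: "(\<lambda>\<omega>. g k (X \<omega> $ k)) = (if k \<in> {i, j}
      then (\<lambda>\<omega>. (X \<omega> $ k - 1) + v $ k * (X \<omega> $ k - 1)\<^sup>2)
      else (\<lambda>\<omega>. 1 + v $ k * (X \<omega> $ k - 1)))" for k
    by (auto simp: g_def power2_eq_square algebra_simps)
  have gi: "integrable M (\<lambda>\<omega>. g k (X \<omega> $ k))" for k
    unfolding g using sm by auto
  have ge: "expectation (\<lambda>\<omega>. g k (X \<omega> $ k)) = (if k \<in> {i, j}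
      then v $ k * (expectation (\<lambda>\<omega>. (X \<omega> $ k)\<^sup>2) + 1) - 1 else 1 - v $ k)" for k
    unfolding g using sm mean by (auto simp: prob_space)
  have gind: "indep_vars (\<lambda>_. borel) (\<lambda>k \<omega>. g k (X \<omega> $ k)) UNIV"
    by (rule indep_vars_compose2[OF ind]) (auto simp: g_def)
  have Y: "Y v = (\<lambda>\<omega>. \<Prod>k\<in>UNIV. g k (X \<omega> $ k))"
  proof
    fix \<omega>
    have "(\<Prod>k\<in>UNIV. if k \<in> {i, j} then X \<omega> $ k - 1 else 1) = (\<Prod>k\<in>{i, j}. X \<omega> $ k - 1)"
      by (subst prod.inter_restrict[symmetric]) auto
    then show "Y v \<omega> = (\<Prod>k\<in>UNIV. g k (X \<omega> $ k))"
      using \<open>i \<noteq> j\<close> unfolding Y_def g_def product_node_altdef prod.distrib by simp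
  qed
  show "integrable M (Y v)"
    unfolding Y by (rule indep_vars_integrable[OF _ gind gi]) auto
  show "expectation (Y v) = (\<Prod>k\<in>UNIV. if k \<in> {i, j}
           then v $ k * (expectation (\<lambda>\<omega>. (X \<omega> $ k)\<^sup>2) + 1) - 1 else 1 - v $ k)"
    unfolding Y by (subst indep_vars_lebesgue_integral[OF _ gind gi]) (auto simp: ge)
qed

section \<open>Negative expected curvature at the origin\<close>

theorem propositionD3:
  fixes P :: "'a measure"
    and M :: nat
    and x :: "nat \<Rightarrow> 'a \<Rightarrow> real ^ 'n"
  assumes "prob_space P"
    and "CARD('n) \<ge> 2"
    and "M \<ge> 1"
    and indep: "prob_space.indep_vars P (\<lambda>_. borel) (\<lambda>(m, i) \<omega>. x m \<omega> $ i) ({1..M} \<times> UNIV)"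
    and ident: "\<And>m i m' i'. m \<in> {1..M} \<Longrightarrow> m' \<in> {1..M} \<Longrightarrow>
      distr P borel (\<lambda>\<omega>. x m \<omega> $ i) = distr P borel (\<lambda>\<omega>. x m' \<omega> $ i')"
    and mean: "\<And>m i. m \<in> {1..M} \<Longrightarrow> prob_space.expectation P (\<lambda>\<omega>. x m \<omega> $ i) = 0"
    and second_moment_finite: "\<And>m i. m \<in> {1..M} \<Longrightarrow> integrable P (\<lambda>\<omega>. (x m \<omega> $ i)\<^sup>2)"
    and second_moment_pos: "\<And>m i. m \<in> {1..M} \<Longrightarrow>
      0 < prob_space.expectation P (\<lambda>\<omega>. (x m \<omega> $ i)\<^sup>2)"
  shows "(\<exists>w w_true q.
            integrable P (\<lambda>\<omega>. hessian (empirical_risk M (\<lambda>m. x m \<omega>) w_true) w) \<and>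
            q \<bullet> (prob_space.expectation P
                   (\<lambda>\<omega>. hessian (empirical_risk M (\<lambda>m. x m \<omega>) w_true) w) *v q) < 0) \<and>
         \<not> (\<forall>w w_true. positive_semidefinite (prob_space.expectation P
                   (\<lambda>\<omega>. hessian (empirical_risk M (\<lambda>m. x m \<omega>) w_true) w))) \<and>
         \<not> (\<forall>w w_true. AE \<omega> in P.
              positive_semidefinite (hessian (empirical_risk M (\<lambda>m. x m \<omega>) w_true) w))"
proof -
  interpret prob_space P by fact
  obtain a b :: 'n where ab: "a \<noteq> b"
    using \<open>CARD('n) \<ge> 2\<close> by (metis card_2_iff' obtain_subset_with_card_n)
  \<comment> \<open>With weight c in place of 3, the expected form per sample tends to 12 - 4 (c -
    1)^2 as the second moments tend to 0; 3 is the least positive integer that makes this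
    negative.\<close>
  define v :: "real ^ 'n" where "v = 3 *\<^sub>R axis a 1 + 3 *\<^sub>R axis b 1"
  define q :: "real ^ 'n" where "q = axis a 1 + axis b 1"
  define S where "S m i = expectation (\<lambda>\<omega>. (x m \<omega> $ i)\<^sup>2)" for m i
  define H where "H \<omega> = hessian (empirical_risk M (\<lambda>m. x m \<omega>) v) 0" for \<omega>
  define h where "h m i j \<omega> = 2 * ((x m \<omega> $ i - 1) * (x m \<omega> $ j - 1)) +
       (if i = j then 0
        else 2 * (1 - product_node v (x m \<omega>)) * ((x m \<omega> $ i - 1) * (x m \<omega> $ j - 1)))" for m i j \<omega>
  have Hh: "H \<omega> $ i $ j = 1 / real M * (\<Sum>m=1..M. h m i j \<omega>)" for \<omega> i j
    unfolding H_def h_def by (rule hessian_empirical_risk_0)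
  have ind: "indep_vars (\<lambda>_. borel) (\<lambda>k \<omega>. x m \<omega> $ k) UNIV" if m: "m \<in> {1..M}" for m
  proof -
    \<comment> \<open>The coordinates of sample \<open>m\<close> are the subfamily over the image of
      \<open>Pair m\<close>.\<close>
    have "indep_vars (\<lambda>_. borel) (\<lambda>(m, i) \<omega>. x m \<omega> $ i) (Pair m ` UNIV)"
      by (rule indep_vars_subset[OF indep]) (use m in auto)
    from indep_vars_reindex[OF _ this] show ?thesis
      by (simp add: inj_on_def comp_def)
  qed
  have meas: "random_variable borel (\<lambda>\<omega>. x m \<omega> $ k)" if "m \<in> {1..M}" for m k
    using ind[OF that] by (auto simp: indep_vars_def)
  note sm = second_moment_shift[OF meas second_moment_finite mean]
  note mm = product_node_mixed_moment[OF ind second_moment_finite mean]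
  have h_diag: "h m i i = (\<lambda>\<omega>. 2 * (x m \<omega> $ i - 1)\<^sup>2)" for m i
    by (auto simp: h_def power2_eq_square)
  \<comment> \<open>Since the node at weights 0 is 1, inserting \<open>product_node 0\<close> makes
    both terms instances of the mixed moment.\<close>
  have h_off: "h m i j = (\<lambda>\<omega>. 4 * ((x m \<omega> $ i - 1) * (x m \<omega> $ j - 1) * product_node 0 (x m \<omega>))
      - 2 * ((x m \<omega> $ i - 1) * (x m \<omega> $ j - 1) * product_node v (x m \<omega>)))" if "i \<noteq> j" for m i j
    using that by (auto simp: h_def product_node_altdef algebra_simps)
  have hi: "integrable P (h m i j)" if "m \<in> {1..M}" for m i j
  proof (cases "i = j")
    case True
    then show ?thesis using sm(2)[OF that that that] by (simp add: h_diag)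
  next
    case False
    then show ?thesis
      unfolding h_off[OF False] using mm(1)[OF that that that False] by auto
  qed
  have Hi: "integrable P H"
    by (rule integrable_matrixI, unfold Hh)
      (intro integrable_mult_right Bochner_Integration.integrable_sum hi)
  have h_diag_exp: "expectation (h m i i) = 2 * (S m i + 1)" if "m \<in> {1..M}" for m i
    using sm(3)[OF that that that] by (simp add: h_diag S_def)
  \<comment> \<open>The set equation covers both orders of \<open>a\<close> and
    \<open>b\<close>.\<close>
  have h_off_exp: "expectation (h m i j) = 4 - 2 * ((3 * S m a + 2) * (3 * S m b + 2))"
    if m: "m \<in> {1..M}" and ij: "i \<noteq> j" "{i, j} = {a, b}" for m i j
  proof -
    note mi = mm(1)[OF m m m ij(1)] and me = mm(2)[OF m m m ij(1), unfolded ij(2), folded S_def]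
    have "(\<Prod>k\<in>UNIV. if k \<in> {a, b} then v $ k * (S m k + 1) - 1 else 1 - v $ k) =
        (\<Prod>k\<in>UNIV. if k \<in> {a, b} then 3 * S m k + 2 else 1)"
      using ab by (intro prod.cong) (auto simp: v_def axis_def)
    also have "\<dots> = (\<Prod>k\<in>{a, b}. 3 * S m k + 2)"
      by (subst prod.inter_restrict[symmetric]) auto
    finally have 1: "(\<Prod>k\<in>UNIV. if k \<in> {a, b} then v $ k * (S m k + 1) - 1 else 1 - v $ k) =
        (3 * S m a + 2) * (3 * S m b + 2)"
      using ab by simp
    \<comment> \<open>At weights 0 the two merged factors each have mean -1, with product 1.\<close>
    have "(\<Prod>k\<in>UNIV. if k \<in> {a, b} then (0 :: real ^ 'n) $ k * (S m k + 1) - 1 else 1 - (0 :: real ^ 'n) $ k) =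
        (\<Prod>k\<in>UNIV. if k \<in> {a, b} then -1 else 1)"
      by (intro prod.cong) auto
    also have "\<dots> = (\<Prod>k\<in>{a, b}. -1)"
      by (subst prod.inter_restrict[symmetric]) auto
    finally have 2: "(\<Prod>k\<in>UNIV. if k \<in> {a, b} then (0 :: real ^ 'n) $ k * (S m k + 1) - 1
        else 1 - (0 :: real ^ 'n) $ k) = 1"
      using ab by simp
    show ?thesis
      unfolding h_off[OF ij(1)] using mi me[of v] me[of 0] unfolding 1 2 by simp
  qed
  have quad: "q \<bullet> (H \<omega> *v q) =
      1 / real M * (\<Sum>m=1..M. h m a a \<omega> + h m a b \<omega> + h m b a \<omega> + h m b b \<omega>)" for \<omega>
    by (simp add: q_def inner_add_left inner_add_right matrix_vector_right_distrib
        inner_matrix_axis Hh sum.distrib add_divide_distrib)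
  have neg: "expectation (\<lambda>\<omega>. q \<bullet> (H \<omega> *v q)) < 0"
  proof -
    have "expectation (\<lambda>\<omega>. q \<bullet> (H \<omega> *v q)) = 1 / real M * (\<Sum>m=1..M. expectation (h m a a) +
        expectation (h m a b) + expectation (h m b a) + expectation (h m b b))"
      unfolding quad using hi by (simp add: Bochner_Integration.integral_sum)
    also have "\<dots> = 1 / real M * (\<Sum>m=1..M. 2 * (S m a + 1) + 2 * (S m b + 1) + 8
        - 4 * ((3 * S m a + 2) * (3 * S m b + 2)))"
      using ab by (intro arg_cong2[where f = "(*)"] sum.cong refl)
        (simp add: h_diag_exp h_off_exp insert_commute)
    also have "\<dots> < 0"
    proof -
      \<comment> \<open>The left side expands to -4 - 22 (\<open>S m a\<close> +
        \<open>S m b\<close>) - 36 \<open>S m a * S m b\<close>; the positive product is supplied as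
        a fact to keep the reasoning linear.\<close>
      have "2 * (S m a + 1) + 2 * (S m b + 1) + 8 - 4 * ((3 * S m a + 2) * (3 * S m b + 2)) < 0"
        if "m \<in> {1..M}" for m
      proof -
        have "0 < S m a" "0 < S m b"
          using second_moment_pos[OF that] by (auto simp: S_def)
        moreover from this have "0 < S m a * S m b" by (rule mult_pos_pos)
        ultimately show ?thesis by argo
      qed
      then have "(\<Sum>m=1..M. 2 * (S m a + 1) + 2 * (S m b + 1) + 8
          - 4 * ((3 * S m a + 2) * (3 * S m b + 2))) < 0"
        using \<open>M \<ge> 1\<close> by (intro sum_strict_mono[where g = "\<lambda>_. 0", simplified]) auto
      then show ?thesis
        using \<open>M \<ge> 1\<close> by (simp add: divide_neg_pos)
    qed
    finally show ?thesis .
  qed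
  \<comment> \<open>Integrability of \<open>H\<close> allows the form to move inside; the integral
    is then a genuine expectation, not the default value 0.\<close>
  have neg': "q \<bullet> (expectation H *v q) < 0"
    using neg integral_bounded_linear[OF bounded_linear_quadratic_form Hi, of q] by simp
  \<comment> \<open>Almost sure semidefiniteness would make the expected form nonnegative, so the
    same \<open>v\<close> and \<open>q\<close> settle this claim too.\<close>
  have "\<not> (AE \<omega> in P. positive_semidefinite (H \<omega>))"
  proof
    assume "AE \<omega> in P. positive_semidefinite (H \<omega>)"
    then have "0 \<le> expectation (\<lambda>\<omega>. q \<bullet> (H \<omega> *v q))"
      by (intro integral_nonneg_AE) (auto simp: positive_semidefinite_def)
    with neg show False by simp
  qed
  with Hi neg' show ?thesis
    unfolding H_def positive_semidefinite_def by (meson not_le)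
qed

end
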